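(* Let $T$ be a finite tree with $n$ vertices and let $\chi_T(x)=\det(x\,\mathrm{Id}_n-A)\in\mathbb Z[x]$ be the characteristic polynomial of its adjacency matrix $A$. Then for every prime power $q$, the number of invertible Schr\"odinger operators of $T$ over the finite field $\mathbb F_q$ equals $$\left(-\sqrt{-q}\right)^n\chi_T\!\left(\sqrt{-q}+1/\sqrt{-q}\right).$$
   Context: All graphs are finite, with unoriented edges, no loops and no multiple edges. A Schr\"odinger operator of a graph $G$ with vertex set $V$ over a field $\mathbb F$ is a matrix of the form $A+D$, where $A$ is the adjacency matrix of $G$ (rows and columns indexed by $V$) and $D$ is an arbitrary diagonal matrix with entries in $\mathbb F$. The number of invertible Schr\"odinger operators over $\mathbb F_q$ is thus the number of diagonal matrices $D$ over $\mathbb F_q$ such that $A+D$ is invertible. *)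

theory Defs
  imports "HOL-Analysis.Analysis" "HOL-Computational_Algebra.Polynomial"
begin

text \<open>
  The vertex set of a graph is the whole of a (finite, hence nonempty) type \<open>'v\<close>; an unoriented
  edge between \<open>u\<close> and \<open>v\<close> is represented by the two pairs \<open>(u, v)\<close> and \<open>(v, u)\<close>.
\<close>

definition simple_graph :: "'v rel \<Rightarrow> bool" where
  "simple_graph E \<longleftrightarrow> sym E \<and> irrefl E"

definition connected_graph :: "'v rel \<Rightarrow> bool" where
  "connected_graph E \<longleftrightarrow> (\<forall>u v. (u, v) \<in> E\<^sup>*)"

text \<open>
  The bound \<open>3 \<le> length c\<close> prevents going back and forth along one edge from counting as a cycle.
\<close>

definition graph_cycle :: "'v rel \<Rightarrow> 'v list \<Rightarrow> bool" where
  "graph_cycle E c \<longleftrightarrow> 3 \<le> length c \<and> distinct c \<and>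
     (\<forall>i < length c. (c ! i, c ! (Suc i mod length c)) \<in> E)"

definition tree_graph :: "'v rel \<Rightarrow> bool" where
  "tree_graph E \<longleftrightarrow> simple_graph E \<and> connected_graph E \<and> (\<nexists>c. graph_cycle E c)"

definition adjacency_matrix :: "('v::finite) rel \<Rightarrow> ('a::zero_neq_one) ^ 'v ^ 'v" where
  "adjacency_matrix E = (\<chi> i j. if (i, j) \<in> E then 1 else 0)"

definition diagonal_matrix :: "('a::zero) ^ 'v ^ 'v \<Rightarrow> bool" where
  "diagonal_matrix D \<longleftrightarrow> (\<forall>i j. i \<noteq> j \<longrightarrow> D $ i $ j = 0)"

definition schroedinger_operator :: "('v::finite) rel \<Rightarrow> ('a::field) ^ 'v ^ 'v \<Rightarrow> bool" where
  "schroedinger_operator E M \<longleftrightarrow> (\<exists>D. diagonal_matrix D \<and> M = adjacency_matrix E + D)"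

definition charpoly :: "('a::comm_ring_1) ^ 'v ^ 'v \<Rightarrow> 'a poly" where
  "charpoly A = det (mat [:0, 1:] - map_matrix (\<lambda>a. [:a:]) A)"

definition graph_charpoly :: "('v::finite) rel \<Rightarrow> int poly" where
  "graph_charpoly E = charpoly (adjacency_matrix E)"

end

theory Submission
  imports Defs
begin

text \<open>
  Only acyclicity of \<open>T\<close> matters, so one may induct over the induced subgraphs on vertex sets \<open>S\<close>.
  Let \<open>v\<close> be a leaf of \<open>S\<close> with neighbour \<open>u\<close>, and let \<open>M\<^sub>S\<close> be a Schroedinger operator of \<open>S\<close> with
  diagonal \<open>d\<close>. Then \<open>det M\<^sub>S = d\<^sub>v a - b\<close> where \<open>a\<close> and \<open>b\<close> are the determinants for \<open>S - {v}\<close> and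
  \<open>S - {u, v}\<close>. If \<open>a \<noteq> 0\<close>, then \<open>q - 1\<close> values of \<open>d\<^sub>v\<close> make this nonzero; if \<open>a = 0 \<noteq> b\<close>, all \<open>q\<close>
  values do; otherwise none. As \<open>a\<close> is affine in \<open>d\<^sub>u\<close> with slope \<open>b\<close>, each choice of diagonal on
  \<open>S - {u, v}\<close> with \<open>b \<noteq> 0\<close> admits exactly one \<open>d\<^sub>u\<close> with \<open>a = 0\<close>. Hence the numbers of invertible
  operators satisfy \<open>N(S) = (q - 1) N(S - {v}) + q N(S - {u, v})\<close>. This is the recursion
  \<open>\<chi>\<^sub>S(x) = x \<chi>\<^bsub>S - {v}\<^esub>(x) - \<chi>\<^bsub>S - {u, v}\<^esub>(x)\<close> at \<open>x = s + 1/s\<close>, \<open>s\<^sup>2 = -q\<close>, rescaled by \<open>(-s)\<^bsup>|S|\<^esup>\<close>.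
\<close>

section \<open>Principal minors\<close>

text \<open>
  The principal submatrix on \<open>S\<close> is extended by the identity outside \<open>S\<close>, so that the submatrices
  for all \<open>S\<close> have the same type.
\<close>

definition principal_block :: "'n set \<Rightarrow> 'a::zero_neq_one ^ 'n ^ 'n \<Rightarrow> 'a ^ 'n ^ 'n" where
  "principal_block S A = (\<chi> i j. if i \<in> S \<and> j \<in> S then A $ i $ j else of_bool (i = j))"

definition principal_minor :: "'n::finite set \<Rightarrow> 'a::comm_ring_1 ^ 'n ^ 'n \<Rightarrow> 'a" where
  "principal_minor S A = det (principal_block S A)"

lemma principal_block_nth [simp]:
  "principal_block S A $ i $ j = (if i \<in> S \<and> j \<in> S then A $ i $ j else of_bool (i = j))"
  by (simp add: principal_block_def)

lemma principal_block_principal_block: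
  "principal_block S (principal_block T A) = principal_block (S \<inter> T) A"
  by (auto simp: vec_eq_iff)

lemma principal_minor_empty [simp]: "principal_minor {} A = 1"
proof -
  have "principal_block {} A = mat 1"
    by (simp add: vec_eq_iff mat_def)
  then show ?thesis
    by (simp add: principal_minor_def)
qed

lemma principal_minor_UNIV [simp]: "principal_minor UNIV A = det A"
proof -
  have "principal_block UNIV A = A"
    by (simp add: vec_eq_iff)
  then show ?thesis
    by (simp add: principal_minor_def)
qed

lemma principal_minor_cong:
  assumes "\<And>i j. i \<in> S \<Longrightarrow> j \<in> S \<Longrightarrow> A $ i $ j = B $ i $ j"
  shows "principal_minor S A = principal_minor S B"
proof -
  have "principal_block S A = principal_block S B"
    using assms by (simp add: vec_eq_iff)
  then show ?thesis
    by (simp add: principal_minor_def)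
qed

lemma principal_minor_transpose: "principal_minor S (transpose A) = principal_minor S A"
proof -
  have "principal_block S (transpose A) = transpose (principal_block S A)"
    by (auto simp: vec_eq_iff transpose_def)
  then show ?thesis
    by (simp add: principal_minor_def)
qed

lemma det_single_entry_row:
  fixes A :: "'a::comm_ring_1 ^ 'n::finite ^ 'n"
  assumes "\<And>j. j \<noteq> v \<Longrightarrow> A $ v $ j = 0"
  shows "det A = A $ v $ v * principal_minor (- {v}) A"
  unfolding principal_minor_def det_def sum_distrib_left
proof (rule sum.cong[OF refl])
  fix p :: "'n \<Rightarrow> 'n"
  assume "p \<in> {p. p permutes UNIV}"
  then have inj: "inj p"
    by (simp add: permutes_inj)
  have prod_split: "(\<Prod>i\<in>UNIV. B $ i $ p i) = B $ v $ p v * (\<Prod>i\<in>UNIV - {v}. B $ i $ p i)"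
    for B :: "'a ^ 'n ^ 'n"
    by (simp add: prod.remove)
  show "of_int (sign p) * (\<Prod>i\<in>UNIV. A $ i $ p i) =
    A $ v $ v * (of_int (sign p) * (\<Prod>i\<in>UNIV. principal_block (- {v}) A $ i $ p i))"
  proof (cases "p v = v")
    case True
    have "p i \<noteq> v" if "i \<noteq> v" for i
      using inj True that by (metis injD)
    then have "(\<Prod>i\<in>UNIV - {v}. principal_block (- {v}) A $ i $ p i) =
        (\<Prod>i\<in>UNIV - {v}. A $ i $ p i)"
      by (intro prod.cong) auto
    with True show ?thesis
      unfolding prod_split by simp
  next
    case False
    then show ?thesis
      unfolding prod_split using assms by auto
  qed
qed

lemma principal_minor_single_entry_row:
  fixes A :: "'a::comm_ring_1 ^ 'n::finite ^ 'n"
  assumes "v \<in> S" "\<And>j. j \<in> S - {v} \<Longrightarrow> A $ v $ j = 0"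
  shows "principal_minor S A = A $ v $ v * principal_minor (S - {v}) A"
proof -
  have "det (principal_block S A) =
      principal_block S A $ v $ v * principal_minor (- {v}) (principal_block S A)"
    by (rule det_single_entry_row) (use assms in auto)
  then show ?thesis
    using assms(1)
    by (simp add: principal_minor_def principal_block_principal_block Diff_eq Int_commute)
qed

lemma principal_minor_single_entry_column:
  fixes A :: "'a::comm_ring_1 ^ 'n::finite ^ 'n"
  assumes "v \<in> S" "\<And>i. i \<in> S - {v} \<Longrightarrow> A $ i $ v = 0"
  shows "principal_minor S A = A $ v $ v * principal_minor (S - {v}) A"
  using principal_minor_single_entry_row[of v S "transpose A"] assms
  unfolding principal_minor_transpose by (simp add: transpose_def)

definition clear_diagonal_entry :: "'n \<Rightarrow> 'a::zero ^ 'n ^ 'n \<Rightarrow> 'a ^ 'n ^ 'n" where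
  "clear_diagonal_entry v A = (\<chi> i j. if i = v \<and> j = v then 0 else A $ i $ j)"

lemma clear_diagonal_entry_nth [simp]:
  "clear_diagonal_entry v A $ i $ j = (if i = v \<and> j = v then 0 else A $ i $ j)"
  by (simp add: clear_diagonal_entry_def)

lemma det_expand_diagonal_entry:
  fixes A :: "'a::comm_ring_1 ^ 'n::finite ^ 'n"
  shows "det A = A $ v $ v * principal_minor (- {v}) A + det (clear_diagonal_entry v A)"
proof -
  let ?e = "A $ v $ v *s axis v 1"
  let ?D = "(\<chi> i. if i = v then ?e else A $ i) :: 'a ^ 'n ^ 'n"
  let ?Z = "clear_diagonal_entry v A"
  have "det A = det (\<chi> i. if i = v then ?e + ?Z $ v else A $ i)"
    by (intro arg_cong[where f = det]) (auto simp: vec_eq_iff axis_def)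
  also have "\<dots> = det ?D + det (\<chi> i. if i = v then ?Z $ v else A $ i)"
    by (rule det_row_add)
  also have "(\<chi> i. if i = v then ?Z $ v else A $ i) = ?Z"
    by (auto simp: vec_eq_iff)
  also have "det ?D = ?D $ v $ v * principal_minor (- {v}) ?D"
    by (rule det_single_entry_row) (auto simp: axis_def)
  also have "principal_minor (- {v}) ?D = principal_minor (- {v}) A"
    by (rule principal_minor_cong) simp
  finally show ?thesis
    by (simp add: axis_def)
qed

lemma principal_minor_expand_diagonal_entry:
  fixes A :: "'a::comm_ring_1 ^ 'n::finite ^ 'n"
  assumes "v \<in> S"
  shows "principal_minor S A =
    A $ v $ v * principal_minor (S - {v}) A + principal_minor S (clear_diagonal_entry v A)"
proof -
  have "clear_diagonal_entry v (principal_block S A) = principal_block S (clear_diagonal_entry v A)"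
    using assms by (auto simp: vec_eq_iff)
  then show ?thesis
    using det_expand_diagonal_entry[of "principal_block S A" v] assms
    by (simp add: principal_minor_def principal_block_principal_block Diff_eq Int_commute)
qed

lemma principal_minor_single_off_diagonal_entry:
  fixes A :: "'a::comm_ring_1 ^ 'n::finite ^ 'n"
  assumes "v \<in> S" "u \<in> S" "u \<noteq> v"
    and row: "\<And>j. j \<in> S - {u} \<Longrightarrow> A $ v $ j = 0"
    and col: "\<And>i. i \<in> S - {u} \<Longrightarrow> A $ i $ v = 0"
  shows "principal_minor S A = - (A $ u $ v * A $ v $ u * principal_minor (S - {u, v}) A)"
proof -
  let ?t = "Transposition.transpose u v"
  let ?C = "(\<chi> i. A $ ?t i) :: 'a ^ 'n ^ 'n"
  have swap: "?t u = v" "?t v = u" "\<And>i. i \<noteq> u \<Longrightarrow> i \<noteq> v \<Longrightarrow> ?t i = i"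
    by (simp_all add: Transposition.transpose_def)
  have "det (\<chi> i. principal_block S A $ ?t i) = - principal_minor S A"
    using assms(3) unfolding principal_minor_def
    by (subst det_permute_rows) (simp_all add: permutes_swap_id sign_swap_id)
  moreover have "(\<chi> i. principal_block S A $ ?t i) = principal_block S ?C"
    using assms(1,2) by (auto simp: vec_eq_iff Transposition.transpose_def)
  ultimately have "principal_minor S A = - principal_minor S ?C"
    by (simp add: principal_minor_def)
  also have "principal_minor S ?C = ?C $ u $ u * principal_minor (S - {u}) ?C"
    by (rule principal_minor_single_entry_row) (use assms(2) row in \<open>auto simp: swap\<close>)
  also have "principal_minor (S - {u}) ?C = ?C $ v $ v * principal_minor (S - {u} - {v}) ?C"
    by (rule principal_minor_single_entry_column) (use assms(1,3) col in \<open>auto simp: swap\<close>)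
  also have "principal_minor (S - {u} - {v}) ?C = principal_minor (S - {u, v}) A"
    unfolding Diff_insert2[symmetric] by (rule principal_minor_cong) (simp add: swap)
  finally show ?thesis
    by (simp add: swap mult_ac)
qed

section \<open>Leaves of forests\<close>

definition forest_graph :: "'v rel \<Rightarrow> bool" where
  "forest_graph E \<longleftrightarrow> simple_graph E \<and> (\<nexists>c. graph_cycle E c)"

lemma tree_graph_imp_forest_graph: "tree_graph E \<Longrightarrow> forest_graph E"
  by (simp add: tree_graph_def forest_graph_def)

definition graph_path :: "'v rel \<Rightarrow> 'v list \<Rightarrow> bool" where
  "graph_path E c \<longleftrightarrow> c \<noteq> [] \<and> distinct c \<and> successively (\<lambda>u v. (u, v) \<in> E) c"

lemma graph_cycle_take_path:
  assumes path: "graph_path E c" and "2 \<le> k" "k < length c" and closing: "(c ! k, c ! 0) \<in> E"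
  shows "graph_cycle E (take (Suc k) c)"
proof -
  have len: "length (take (Suc k) c) = Suc k"
    using assms(3) by simp
  have "(take (Suc k) c ! i, take (Suc k) c ! (Suc i mod Suc k)) \<in> E" if "i < Suc k" for i
  proof (cases "i = k")
    case True
    then show ?thesis
      using closing by simp
  next
    case False
    then have "(c ! i, c ! Suc i) \<in> E"
      using path assms(3) that successively_nth[of "\<lambda>u v. (u, v) \<in> E" c i]
      by (simp add: graph_path_def)
    then show ?thesis
      using False that by simp
  qed
  then show ?thesis
    unfolding graph_cycle_def len using path assms(2) by (auto simp: graph_path_def)
qed

lemma ex_graph_path_maximal_at_hd:
  assumes "sym E" "finite S" "S \<noteq> {}"
  shows "\<exists>c. graph_path E c \<and> set c \<subseteq> S \<and> S \<inter> E `` {hd c} \<subseteq> set c"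
proof -
  let ?P = "\<lambda>c. graph_path E c \<and> set c \<subseteq> S"
  obtain x where "x \<in> S"
    using assms(3) by blast
  then have "?P [x]"
    by (simp add: graph_path_def)
  moreover have "\<forall>c. ?P c \<longrightarrow> length c < Suc (card S)"
    using assms(2) by (metis graph_path_def card_mono distinct_card le_imp_less_Suc)
  ultimately obtain c where path: "?P c" and longest: "\<And>c'. ?P c' \<Longrightarrow> length c' \<le> length c"
    using ex_has_greatest_nat[of ?P "[x]" length "Suc (card S)"] by blast
  have "w \<in> set c" if "w \<in> S" "(hd c, w) \<in> E" for w
  proof (rule ccontr)
    assume "w \<notin> set c"
    then have "?P (w # c)"
      using path that assms(1) by (auto simp: graph_path_def successively_Cons dest: symD)
    then show False
      using longest by fastforce
  qed
  then show ?thesis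
    using path by blast
qed

lemma forest_graph_leaf:
  assumes "forest_graph E" "finite S" "S \<noteq> {}"
  obtains v u where "v \<in> S" "S \<inter> E `` {v} \<subseteq> {u}"
proof -
  have sym: "sym E" and irrefl: "irrefl E" and acyclic: "\<nexists>c. graph_cycle E c"
    using assms(1) by (auto simp: forest_graph_def simple_graph_def)
  obtain c where path: "graph_path E c" "set c \<subseteq> S" and maximal: "S \<inter> E `` {hd c} \<subseteq> set c"
    using ex_graph_path_maximal_at_hd[OF sym assms(2,3)] by blast
  have head: "hd c = c ! 0" "hd c \<in> S"
    using path by (auto simp: graph_path_def hd_conv_nth)
  have "w = c ! 1" if "w \<in> S" "(hd c, w) \<in> E" for w
  proof (rule ccontr)
    assume "w \<noteq> c ! 1"
    have "w \<in> set c"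
      using maximal that by blast
    then obtain k where index: "k < length c" "c ! k = w"
      by (auto simp: in_set_conv_nth)
    have "k \<noteq> 0"
      using irrefl index that head(1) by (metis irreflD)
    moreover have "k \<noteq> 1"
      using index \<open>w \<noteq> c ! 1\<close> by blast
    ultimately have "graph_cycle E (take (Suc k) c)"
      using path(1) index that sym head by (intro graph_cycle_take_path) (auto dest: symD)
    then show False
      using acyclic by blast
  qed
  then show ?thesis
    using that[of "hd c" "c ! 1"] head(2) by blast
qed

lemma forest_graph_induct [consumes 2, case_names empty isolated leaf]:
  assumes "forest_graph E" "finite S"
    and empty: "P {}"
    and isolated: "\<And>S v. finite S \<Longrightarrow> v \<in> S \<Longrightarrow> S \<inter> E `` {v} = {} \<Longrightarrow> P (S - {v}) \<Longrightarrow> P S"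
    and leaf: "\<And>S v u. finite S \<Longrightarrow> v \<in> S \<Longrightarrow> S \<inter> E `` {v} = {u} \<Longrightarrow>
      P (S - {v}) \<Longrightarrow> P (S - {u, v}) \<Longrightarrow> P S"
  shows "P S"
  using assms(2)
proof (induction S rule: finite_psubset_induct)
  case (psubset S)
  show ?case
  proof (cases "S = {}")
    case True
    with empty show ?thesis
      by simp
  next
    case False
    then obtain v u where "v \<in> S" and "S \<inter> E `` {v} \<subseteq> {u}"
      using forest_graph_leaf[OF assms(1) psubset.hyps] by blast
    then consider "S \<inter> E `` {v} = {}" | "S \<inter> E `` {v} = {u}"
      by blast
    moreover have "P (S - {v})" "P (S - {u, v})"
      using \<open>v \<in> S\<close> by (auto intro!: psubset.IH)
    ultimately show ?thesis
      using isolated leaf psubset.hyps \<open>v \<in> S\<close> by metis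
  qed
qed

lemma simple_graph_leafD:
  assumes "simple_graph E" "S \<inter> E `` {v} = {u}"
  shows "irrefl E" "u \<in> S" "u \<noteq> v" "(u, v) \<in> E" "(v, u) \<in> E"
  using assms by (auto simp: simple_graph_def irrefl_def dest: symD)

section \<open>Principal minors of matrices supported on a graph\<close>

definition graph_supported :: "'v rel \<Rightarrow> 'a::zero ^ 'v ^ 'v \<Rightarrow> bool" where
  "graph_supported E A \<longleftrightarrow> (\<forall>i j. i \<noteq> j \<longrightarrow> (i, j) \<notin> E \<longrightarrow> A $ i $ j = 0)"

lemma principal_minor_isolated:
  fixes A :: "'a::comm_ring_1 ^ 'v::finite ^ 'v"
  assumes "graph_supported E A" "v \<in> S" "S \<inter> E `` {v} = {}"
  shows "principal_minor S A = A $ v $ v * principal_minor (S - {v}) A"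
  using assms
  by (intro principal_minor_single_entry_row) (auto simp: graph_supported_def disjoint_iff)

lemma principal_minor_leaf:
  fixes A :: "'a::comm_ring_1 ^ 'v::finite ^ 'v"
  assumes "graph_supported E A" "simple_graph E" "v \<in> S" and leaf: "S \<inter> E `` {v} = {u}"
  shows "principal_minor S A =
    A $ v $ v * principal_minor (S - {v}) A -
    A $ u $ v * A $ v $ u * principal_minor (S - {u, v}) A"
proof -
  let ?Z = "clear_diagonal_entry v A"
  note neighbour = simple_graph_leafD[OF assms(2) leaf]
  have "(v, j) \<notin> E" "(j, v) \<notin> E" if "j \<in> S - {u}" for j
    using assms(2) leaf that by (auto simp: simple_graph_def dest: symD)
  then have "principal_minor S ?Z = - (?Z $ u $ v * ?Z $ v $ u * principal_minor (S - {u, v}) ?Z)"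
    using assms(1,3) neighbour
    by (intro principal_minor_single_off_diagonal_entry) (auto simp: graph_supported_def)
  also have "principal_minor (S - {u, v}) ?Z = principal_minor (S - {u, v}) A"
    by (rule principal_minor_cong) simp
  finally show ?thesis
    using principal_minor_expand_diagonal_entry[OF assms(3), of A] neighbour by simp
qed

section \<open>Characteristic polynomials of induced subgraphs\<close>

definition characteristic_matrix :: "'a::comm_ring_1 ^ 'n ^ 'n \<Rightarrow> 'a poly ^ 'n ^ 'n" where
  "characteristic_matrix A = mat [:0, 1:] - map_matrix (\<lambda>a. [:a:]) A"

definition subgraph_charpoly :: "'v::finite rel \<Rightarrow> 'v set \<Rightarrow> int poly" where
  "subgraph_charpoly E S = principal_minor S (characteristic_matrix (adjacency_matrix E))"

lemma subgraph_charpoly_empty [simp]: "subgraph_charpoly E {} = 1"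
  by (simp add: subgraph_charpoly_def)

lemma subgraph_charpoly_UNIV: "subgraph_charpoly E UNIV = graph_charpoly E"
  by (simp add: subgraph_charpoly_def graph_charpoly_def charpoly_def characteristic_matrix_def)

lemma characteristic_matrix_adjacency_nth:
  assumes "irrefl E"
  shows "characteristic_matrix (adjacency_matrix E) $ i $ j =
    (if i = j then [:0, 1:] else - of_bool ((i, j) \<in> E))"
  using assms
  by (auto simp: characteristic_matrix_def adjacency_matrix_def mat_def irrefl_def one_pCons)

lemma graph_supported_characteristic_matrix:
  "irrefl E \<Longrightarrow> graph_supported E (characteristic_matrix (adjacency_matrix E))"
  by (simp add: graph_supported_def characteristic_matrix_adjacency_nth)

lemma subgraph_charpoly_isolated:
  assumes "irrefl E" "v \<in> S" "S \<inter> E `` {v} = {}"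
  shows "subgraph_charpoly E S = [:0, 1:] * subgraph_charpoly E (S - {v})"
  using principal_minor_isolated[OF graph_supported_characteristic_matrix assms(2,3)] assms(1)
  by (simp add: subgraph_charpoly_def characteristic_matrix_adjacency_nth)

lemma subgraph_charpoly_leaf:
  assumes "simple_graph E" "v \<in> S" "S \<inter> E `` {v} = {u}"
  shows "subgraph_charpoly E S =
    [:0, 1:] * subgraph_charpoly E (S - {v}) - subgraph_charpoly E (S - {u, v})"
  using principal_minor_leaf[OF graph_supported_characteristic_matrix assms]
    simple_graph_leafD[OF assms(1,3)]
  by (simp add: subgraph_charpoly_def characteristic_matrix_adjacency_nth)

lemma poly_of_int_diff:
  fixes z :: "'a::comm_ring_1"
  shows "poly (map_poly of_int (p - r)) z = poly (map_poly of_int p) z - poly (map_poly of_int r) z"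
proof -
  have "map_poly of_int (p - r) = (map_poly of_int p - map_poly of_int r :: 'a poly)"
    by (intro poly_eqI) (simp add: coeff_map_poly)
  then show ?thesis
    by simp
qed

definition rescaled_charpoly :: "'v::finite rel \<Rightarrow> 'a::field \<Rightarrow> 'v set \<Rightarrow> 'a" where
  "rescaled_charpoly E s S =
    (- s) ^ card S * poly (map_poly of_int (subgraph_charpoly E S)) (s + 1 / s)"

lemma minus_mult_add_inverse:
  fixes s :: "'a::field"
  assumes "s \<noteq> 0"
  shows "- s * (s + 1 / s) = - s\<^sup>2 - 1"
  using assms by (simp add: power2_eq_square distrib_left)

lemma rescaled_charpoly_isolated:
  assumes "s \<noteq> 0" "irrefl E" "v \<in> S" "S \<inter> E `` {v} = {}"
  shows "rescaled_charpoly E s S = (- s\<^sup>2 - 1) * rescaled_charpoly E s (S - {v})"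
proof -
  let ?p = "\<lambda>S. poly (map_poly of_int (subgraph_charpoly E S)) (s + 1 / s)"
  have card_S: "card S = Suc (card (S - {v}))"
    using assms(3) by (intro card.remove) simp_all
  have "?p S = (s + 1 / s) * ?p (S - {v})"
    unfolding subgraph_charpoly_isolated[OF assms(2-4)] by (simp add: map_poly_pCons)
  then have "rescaled_charpoly E s S = - s * (s + 1 / s) * rescaled_charpoly E s (S - {v})"
    by (simp only: rescaled_charpoly_def card_S power_Suc mult_ac)
  then show ?thesis
    by (simp only: minus_mult_add_inverse[OF assms(1)])
qed

lemma rescaled_charpoly_leaf:
  assumes "s \<noteq> 0" "simple_graph E" "v \<in> S" "S \<inter> E `` {v} = {u}"
  shows "rescaled_charpoly E s S =
    (- s\<^sup>2 - 1) * rescaled_charpoly E s (S - {v}) + - s\<^sup>2 * rescaled_charpoly E s (S - {u, v})"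
proof -
  let ?p = "\<lambda>S. poly (map_poly of_int (subgraph_charpoly E S)) (s + 1 / s)"
  have "u \<in> S - {v}"
    using simple_graph_leafD[OF assms(2,4)] by blast
  then have card_S_v: "card (S - {v}) = Suc (card (S - {u, v}))"
    unfolding Diff_insert[of S u "{v}"] by (intro card.remove) simp_all
  have card_S: "card S = Suc (card (S - {v}))"
    using assms(3) by (intro card.remove) simp_all
  have "(- s) ^ Suc (Suc m) * (x * a - b) =
      (- s * x) * ((- s) ^ Suc m * a) + - s\<^sup>2 * ((- s) ^ m * b)" for m x a b
    by (simp add: power2_eq_square algebra_simps)
  moreover have "?p S = (s + 1 / s) * ?p (S - {v}) - ?p (S - {u, v})"
    unfolding subgraph_charpoly_leaf[OF assms(2-4)] by (simp add: poly_of_int_diff map_poly_pCons)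
  ultimately have "rescaled_charpoly E s S = - s * (s + 1 / s) * rescaled_charpoly E s (S - {v}) +
      - s\<^sup>2 * rescaled_charpoly E s (S - {u, v})"
    by (simp only: rescaled_charpoly_def card_S card_S_v)
  then show ?thesis
    by (simp only: minus_mult_add_inverse[OF assms(1)])
qed

section \<open>Counting solutions of affine conditions\<close>

lemma card_PiE_insert_filter:
  assumes "finite S" "v \<notin> S" "\<And>i. i \<in> insert v S \<Longrightarrow> finite (A i)"
  shows "card {d \<in> PiE (insert v S) A. P d} = (\<Sum>d\<in>PiE S A. card {x \<in> A v. P (d(v := x))})"
proof -
  let ?extend = "\<lambda>(x, d). d(v := x)"
  let ?X = "{z \<in> A v \<times> PiE S A. P (?extend z)}"
  have "{d \<in> PiE (insert v S) A. P d} = ?extend ` ?X"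
    by (auto simp: PiE_insert_eq)
  moreover have "inj_on ?extend ?X"
    by (rule inj_on_subset[OF inj_combinator[OF assms(2)]]) auto
  ultimately have "card {d \<in> PiE (insert v S) A. P d} = card ?X"
    by (simp add: card_image)
  also have "\<dots> = card (prod.swap ` ?X)"
    by (simp add: card_image)
  also have "prod.swap ` ?X = (SIGMA d:PiE S A. {x \<in> A v. P (d(v := x))})"
    by force
  also have "card \<dots> = (\<Sum>d\<in>PiE S A. card {x \<in> A v. P (d(v := x))})"
    using assms by (intro card_SigmaI) (auto intro: finite_PiE)
  finally show ?thesis .
qed

lemma card_affine_eq_0:
  fixes a b :: "'a::field"
  assumes "a \<noteq> 0"
  shows "card {x. x * a + b = 0} = 1"
proof -
  have "{x. x * a + b = 0} = {- b / a}"
    using assms by (auto simp: field_simps eq_neg_iff_add_eq_0)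
  then show ?thesis
    by simp
qed

lemma card_affine_neq_0:
  fixes a b :: "'f::{field,finite}"
  shows "card {x. x * a + b \<noteq> 0} =
    (CARD('f) - 1) * of_bool (a \<noteq> 0) + CARD('f) * of_bool (a = 0 \<and> b \<noteq> 0)"
proof (cases "a = 0")
  case False
  have "card {x. x * a + b \<noteq> 0} = CARD('f) - card {x. x * a + b = 0}"
    by (subst card_Diff_subset[symmetric]) (auto intro!: arg_cong[where f = card])
  then show ?thesis
    using False by (simp add: card_affine_eq_0)
qed simp

lemma card_PiE_insert_affine_neq_0:
  fixes f a b :: "('v \<Rightarrow> 'f::{field,finite}) \<Rightarrow> 'f"
  assumes "finite S" "v \<notin> S" and affine: "\<And>d x. f (d(v := x)) = x * a d + b d"
  shows "card {d \<in> insert v S \<rightarrow>\<^sub>E UNIV. f d \<noteq> 0} =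
    (CARD('f) - 1) * card {d \<in> S \<rightarrow>\<^sub>E UNIV. a d \<noteq> 0} +
    CARD('f) * card {d \<in> S \<rightarrow>\<^sub>E UNIV. a d = 0 \<and> b d \<noteq> 0}"
proof -
  have "card {d \<in> insert v S \<rightarrow>\<^sub>E UNIV. f d \<noteq> 0} =
      (\<Sum>d\<in>S \<rightarrow>\<^sub>E UNIV. card {x. x * a d + b d \<noteq> 0})"
    using assms(1,2) by (simp add: card_PiE_insert_filter affine)
  then show ?thesis
    using assms(1)
    by (simp add: card_affine_neq_0 sum.distrib finite_PiE Int_def flip: sum_distrib_left)
qed

lemma card_PiE_insert_affine_eq_0:
  fixes f a b :: "('v \<Rightarrow> 'f::{field,finite}) \<Rightarrow> 'f"
  assumes "finite S" "v \<notin> S" and affine: "\<And>d x. f (d(v := x)) = x * a d + b d"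
    and slope: "\<And>d x. a (d(v := x)) = a d"
  shows "card {d \<in> insert v S \<rightarrow>\<^sub>E UNIV. f d = 0 \<and> a d \<noteq> 0} = card {d \<in> S \<rightarrow>\<^sub>E UNIV. a d \<noteq> 0}"
proof -
  have "card {x. x * a d + b d = 0 \<and> a d \<noteq> 0} = of_bool (a d \<noteq> 0)" for d
    by (simp add: card_affine_eq_0)
  then have "card {d \<in> insert v S \<rightarrow>\<^sub>E UNIV. f d = 0 \<and> a d \<noteq> 0} =
      (\<Sum>d\<in>S \<rightarrow>\<^sub>E UNIV. of_bool (a d \<noteq> 0))"
    using assms(1,2) by (simp add: card_PiE_insert_filter affine slope)
  then show ?thesis
    using assms(1) by (simp add: finite_PiE Int_def)
qed

section \<open>Invertible Schroedinger operators of forests\<close>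

definition schroedinger_matrix :: "'v::finite rel \<Rightarrow> ('v \<Rightarrow> 'a::field) \<Rightarrow> 'a ^ 'v ^ 'v" where
  "schroedinger_matrix E d = adjacency_matrix E + (\<chi> i j. if i = j then d i else 0)"

definition schroedinger_minor :: "'v::finite rel \<Rightarrow> 'v set \<Rightarrow> ('v \<Rightarrow> 'a::field) \<Rightarrow> 'a" where
  "schroedinger_minor E S d = principal_minor S (schroedinger_matrix E d)"

lemma schroedinger_matrix_nth:
  assumes "irrefl E"
  shows "schroedinger_matrix E d $ i $ j = (if i = j then d i else of_bool ((i, j) \<in> E))"
  using assms by (auto simp: schroedinger_matrix_def adjacency_matrix_def irrefl_def)

lemma inj_schroedinger_matrix: "inj (schroedinger_matrix E)"
  by (rule injI) (auto simp: schroedinger_matrix_def vec_eq_iff fun_eq_iff split: if_splits)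

lemma schroedinger_operator_iff_range:
  "schroedinger_operator E M \<longleftrightarrow> M \<in> range (schroedinger_matrix E)"
proof
  assume "schroedinger_operator E M"
  then obtain D where "diagonal_matrix D" "M = adjacency_matrix E + D"
    by (auto simp: schroedinger_operator_def)
  then have "M = schroedinger_matrix E (\<lambda>i. D $ i $ i)"
    by (auto simp: schroedinger_matrix_def vec_eq_iff diagonal_matrix_def)
  then show "M \<in> range (schroedinger_matrix E)"
    by blast
qed (auto simp: schroedinger_operator_def schroedinger_matrix_def diagonal_matrix_def)

lemma graph_supported_schroedinger_matrix:
  "irrefl E \<Longrightarrow> graph_supported E (schroedinger_matrix E d)"
  by (simp add: graph_supported_def schroedinger_matrix_nth)

lemma schroedinger_minor_fun_upd:
  "v \<notin> S \<Longrightarrow> schroedinger_minor E S (d(v := x)) = schroedinger_minor E S d"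
  unfolding schroedinger_minor_def
  by (rule principal_minor_cong) (auto simp: schroedinger_matrix_def)

lemma schroedinger_minor_isolated:
  assumes "irrefl E" "v \<in> S" "S \<inter> E `` {v} = {}"
  shows "schroedinger_minor E S d = d v * schroedinger_minor E (S - {v}) d"
  using principal_minor_isolated[OF graph_supported_schroedinger_matrix assms(2,3)] assms(1)
  by (simp add: schroedinger_minor_def schroedinger_matrix_nth)

lemma schroedinger_minor_leaf:
  assumes "simple_graph E" "v \<in> S" "S \<inter> E `` {v} = {u}"
  shows "schroedinger_minor E S d =
    d v * schroedinger_minor E (S - {v}) d - schroedinger_minor E (S - {u, v}) d"
  using principal_minor_leaf[OF graph_supported_schroedinger_matrix assms]
    simple_graph_leafD[OF assms(1,3)]
  by (simp add: schroedinger_minor_def schroedinger_matrix_nth)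

lemma schroedinger_minor_affine:
  assumes "irrefl E" "u \<in> S"
  shows "schroedinger_minor E S (d(u := x)) = x * schroedinger_minor E (S - {u}) d +
    principal_minor S (clear_diagonal_entry u (schroedinger_matrix E d))"
proof -
  let ?M = "schroedinger_matrix E (d(u := x))"
  have "clear_diagonal_entry u ?M = clear_diagonal_entry u (schroedinger_matrix E d)"
    using assms(1) by (auto simp: vec_eq_iff schroedinger_matrix_nth)
  then have "schroedinger_minor E S (d(u := x)) = x * schroedinger_minor E (S - {u}) (d(u := x)) +
      principal_minor S (clear_diagonal_entry u (schroedinger_matrix E d))"
    using principal_minor_expand_diagonal_entry[OF assms(2), of ?M] assms(1)
    by (simp add: schroedinger_minor_def schroedinger_matrix_nth)
  then show ?thesis
    by (simp add: schroedinger_minor_fun_upd)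
qed

definition invertible_count :: "'v::finite rel \<Rightarrow> 'f::{field,finite} itself \<Rightarrow> 'v set \<Rightarrow> nat" where
  "invertible_count E _ S = card {d \<in> S \<rightarrow>\<^sub>E (UNIV :: 'f set). schroedinger_minor E S d \<noteq> 0}"

lemma invertible_count_empty [simp]: "invertible_count E TYPE('f::{field,finite}) {} = 1"
  by (simp add: invertible_count_def schroedinger_minor_def)

lemma invertible_count_UNIV:
  "invertible_count E TYPE('f::{field,finite}) UNIV =
    card {M :: 'f ^ 'v::finite ^ 'v. schroedinger_operator E M \<and> invertible M}"
proof -
  let ?D = "{d :: 'v \<Rightarrow> 'f. schroedinger_minor E UNIV d \<noteq> 0}"
  have "{M :: 'f ^ 'v ^ 'v. schroedinger_operator E M \<and> invertible M} = schroedinger_matrix E ` ?D"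
    by (auto simp: schroedinger_operator_iff_range invertible_det_nz schroedinger_minor_def)
  then show ?thesis
    by (simp add: invertible_count_def PiE_UNIV_domain card_image
        inj_on_subset[OF inj_schroedinger_matrix])
qed

lemma invertible_count_isolated:
  assumes "irrefl E" "v \<in> S" "S \<inter> E `` {v} = {}"
  shows "invertible_count E TYPE('f::{field,finite}) S =
    (CARD('f) - 1) * invertible_count E TYPE('f) (S - {v})"
proof -
  have "schroedinger_minor E S (d(v := x)) = x * schroedinger_minor E (S - {v}) d + 0"
    for d and x :: 'f
    using schroedinger_minor_isolated[OF assms, of "d(v := x)"]
    by (simp add: schroedinger_minor_fun_upd)
  from card_PiE_insert_affine_neq_0[OF _ _ this, of "S - {v}"] show ?thesis
    using assms(2) by (simp add: invertible_count_def insert_absorb)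
qed

lemma invertible_count_leaf:
  fixes E :: "'v::finite rel"
  assumes "simple_graph E" "v \<in> S" "S \<inter> E `` {v} = {u}"
  shows "invertible_count E TYPE('f::{field,finite}) S =
    (CARD('f) - 1) * invertible_count E TYPE('f) (S - {v}) +
    CARD('f) * invertible_count E TYPE('f) (S - {u, v})"
proof -
  let ?T = "S - {v}" and ?U = "S - {u, v}"
  let ?a = "\<lambda>d :: 'v \<Rightarrow> 'f. schroedinger_minor E ?T d"
  let ?b = "\<lambda>d :: 'v \<Rightarrow> 'f. schroedinger_minor E ?U d"
  note neighbour = simple_graph_leafD[OF assms(1,3)]
  have insert_u: "insert u ?U = ?T" and remove_u: "?T - {u} = ?U"
    using neighbour by blast+
  have "schroedinger_minor E S (d(v := x)) = x * ?a d + - ?b d" for d x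
    using schroedinger_minor_leaf[OF assms, of "d(v := x)"]
    by (simp add: schroedinger_minor_fun_upd)
  from card_PiE_insert_affine_neq_0[OF _ _ this, of ?T]
  have count_S: "invertible_count E TYPE('f) S =
      (CARD('f) - 1) * invertible_count E TYPE('f) ?T +
      CARD('f) * card {d \<in> ?T \<rightarrow>\<^sub>E UNIV. ?a d = 0 \<and> ?b d \<noteq> 0}"
    using assms(2) by (simp add: invertible_count_def insert_absorb)
  have affine: "?a (d(u := x)) = x * ?b d +
      principal_minor ?T (clear_diagonal_entry u (schroedinger_matrix E d))" for d x
    using schroedinger_minor_affine[of E u ?T d x] neighbour by (simp add: remove_u)
  have slope: "?b (d(u := x)) = ?b d" for d x
    by (rule schroedinger_minor_fun_upd) simp
  have "card {d \<in> ?T \<rightarrow>\<^sub>E UNIV. ?a d = 0 \<and> ?b d \<noteq> 0} = invertible_count E TYPE('f) ?U"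
    using card_PiE_insert_affine_eq_0[OF _ _ affine slope, of ?U]
    by (simp add: invertible_count_def insert_u)
  with count_S show ?thesis
    by simp
qed

lemma invertible_count_forest:
  fixes E :: "'v::finite rel" and s :: "'a::field_char_0"
  assumes "forest_graph E" and square: "s\<^sup>2 = - of_nat CARD('f::{field,finite})"
  shows "of_nat (invertible_count E TYPE('f) S) = rescaled_charpoly E s S"
proof -
  have graph: "simple_graph E" "irrefl E"
    using assms(1) by (auto simp: forest_graph_def simple_graph_def)
  have "s \<noteq> 0" and card_field: "of_nat CARD('f) = - s\<^sup>2"
    using square by auto
  have card_field_minus_1: "of_nat (CARD('f) - 1) = - s\<^sup>2 - 1"
    by (simp add: of_nat_diff Suc_leI card_field)
  show ?thesis
    using assms(1) finite[of S]
  proof (induction S rule: forest_graph_induct)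
    case empty
    show ?case
      by (simp add: rescaled_charpoly_def)
  next
    case (isolated S v)
    then show ?case
      by (simp only: invertible_count_isolated[OF graph(2)]
          rescaled_charpoly_isolated[OF \<open>s \<noteq> 0\<close> graph(2)]
          of_nat_mult card_field_minus_1)
  next
    case (leaf S v u)
    then show ?case
      by (simp only: invertible_count_leaf[OF graph(1)]
          rescaled_charpoly_leaf[OF \<open>s \<noteq> 0\<close> graph(1)]
          of_nat_mult of_nat_add card_field card_field_minus_1)
  qed
qed

theorem theorem1:
  fixes E :: "('v::finite) rel" and q :: nat and s :: complex
  assumes "tree_graph E"
    and "q = CARD('f::{field,finite})"
    and "s = csqrt (- of_nat q)"
  shows "of_nat (card {M :: 'f ^ 'v ^ 'v. schroedinger_operator E M \<and> invertible M}) =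
    (- s) ^ CARD('v) * poly (map_poly of_int (graph_charpoly E)) (s + 1 / s)"
proof -
  have "s\<^sup>2 = - of_nat CARD('f)"
    unfolding assms(2,3) by (rule power2_csqrt)
  with tree_graph_imp_forest_graph[OF assms(1)]
  have "of_nat (invertible_count E TYPE('f) UNIV) = rescaled_charpoly E s UNIV"
    by (rule invertible_count_forest)
  then show ?thesis
    by (simp only: invertible_count_UNIV rescaled_charpoly_def subgraph_charpoly_UNIV)
qed

end
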